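(* Let $T$ be a truss, let $M$ be a left $T$-module and let $e\in M$. Let $T[M;e]$ be the truss on $T\times M$ with componentwise heap operation and multiplication $(t,m)(t',m')=(tt',[m,t\cdot e,t\cdot m'])$. (1) For any $\bar e\in M$, $T[M;e]\cong T[M;\bar e]$ as trusses. (2) $M$ is a left $T[M;e]$-module with the action, for all $m,m'\in M$ and $t\in T$, $$(t,m)\cdot m'=[m,t\cdot e,t\cdot m'].$$ In particular, $(t,m)\cdot e=m$. (3) The induced actions of $T[M;e]$ on $M$ (with respect to the action in (2)) coincide with the induced actions of $T$ on $M$, i.e. for all $\bar e\in M$, $t\in T$ and $m,m'\in M$, $$(t,m)\cdot_{\bar e}m'=t\cdot_{\bar e}m'.$$ In particular, if $\bar e$ is an absorber in the $T$-module $M$, then $(t,m)\cdot_{\bar e}m'=t\cdot m'$. (4) For all $a\in T$, the sub-heap $M_a:=\{a\}\times M$ is a paragon in $T[M;e]$. Furthermore, $T[M;e]/M_a\cong T$ (as trusses). $M_a$ is an ideal in $T[M;e]$ if and only if $a$ is an absorber in $T$. (5) The sub-heap $T_e:=T\times\{e\}$ is a sub-truss and a left paragon of $T[M;e]$. Furthermore, $T[M;e]/T_e\cong M$ as left $T[M;e]$-modules (with $M$ carrying the action in (2)). (6) The truss $T[M;e]$ is unital if and only if $T$ is a unital truss and $M$ is a unital module. Furthermore, $\mathrm{U}(T[M;e])=\mathrm{U}(T)\times M$.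
   Context: A heap is a set $H$ with a ternary operation $[-,-,-]$ such that $[[a,b,c],d,e]=[a,b,[c,d,e]]$ and $[b,b,a]=a=[a,b,b]$; it is abelian if $[a,b,c]=[c,b,a]$. A sub-heap is a subset closed under the ternary operation. A truss is an abelian heap $T$ with an associative binary multiplication such that $a[b,c,d]=[ab,ac,ad]$ and $[b,c,d]a=[ba,ca,da]$. A truss is unital if it has a multiplicative identity $1$; $\mathrm{U}(T)$ denotes the set of units (multiplicatively invertible elements) of a unital truss $T$. A sub-truss is a sub-heap closed under multiplication. An absorber in a truss is an element $0$ with $0t=t0=0$ for all $t$. An ideal of a truss $T$ is a sub-heap $J$ with $tx,xt\in J$ for all $t\in T$, $x\in J$. Truss isomorphisms are bijections preserving the ternary operation and multiplication. A left $T$-module is an abelian heap $M$ with an action $(t,m)\mapsto t\cdot m$ such that $t\cdot(t'\cdot m)=(tt')\cdot m$, $[t,t',t'']\cdot m=[t\cdot m,t'\cdot m,t''\cdot m]$ and $t\cdot[m,m',m'']=[t\cdot m,t\cdot m',t\cdot m'']$. It is unital if $T$ is unital and $1\cdot m=m$ for all $m\in M$. An absorber in $M$ is an element $\bar e\in M$ with $t\cdot\bar e=\bar e$ for all $t\in T$. For $\bar e\in M$, the induced action is $t\cdot_{\bar e}m=[t\cdot m,t\cdot\bar e,\bar e]$. The same notions apply to modules over $T[M;e]$. Module isomorphisms are bijections preserving the ternary operation and the action. A left paragon of a truss $T$ is a sub-heap $P$ for which there is $q\in P$ with $[xp,xq,q]\in P$ for all $x\in T$, $p\in P$; a paragon is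 a sub-heap $P$ for which there is $q\in P$ with both $[xp,xq,q]\in P$ and $[px,qx,q]\in P$ for all $x\in T$, $p\in P$. For a sub-heap $P$ of $T$, the sub-heap relation is $x\sim_P y\iff\exists\,p\in P,\ [x,y,p]\in P$, and $T/P$ is the set of its equivalence classes. If $P$ is a paragon, $T/P$ is a truss with the induced operations; if $P$ is a left paragon, $T/P$ is a left $T$-module with the induced heap operation and the action induced by left multiplication.
   Formalization: In (5), the claims that T_e is a left paragon and that T[M;e]/T_e ≅ M are stated for nonempty T; for the empty truss T_e is empty and both claims fail. *)

theory Defs
  imports "HOL-Algebra.Congruence"
begin

section \<open>Heaps\<close>

record 'a heap = "'a partial_object" +
  tern :: "'a \<Rightarrow> 'a \<Rightarrow> 'a \<Rightarrow> 'a"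

text \<open>The carrier of a heap is allowed to be empty.\<close>

locale heap =
  fixes H (structure)
  assumes tern_closed:
      "\<lbrakk>a \<in> carrier H; b \<in> carrier H; c \<in> carrier H\<rbrakk> \<Longrightarrow> tern H a b c \<in> carrier H"
    and tern_assoc:
      "\<lbrakk>a \<in> carrier H; b \<in> carrier H; c \<in> carrier H; d \<in> carrier H; f \<in> carrier H\<rbrakk>
        \<Longrightarrow> tern H (tern H a b c) d f = tern H a b (tern H c d f)"
    and tern_left_cancel:
      "\<lbrakk>a \<in> carrier H; b \<in> carrier H\<rbrakk> \<Longrightarrow> tern H b b a = a"
    and tern_right_cancel:
      "\<lbrakk>a \<in> carrier H; b \<in> carrier H\<rbrakk> \<Longrightarrow> tern H a b b = a"

locale abelian_heap = heap +
  assumes tern_comm: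
    "\<lbrakk>a \<in> carrier H; b \<in> carrier H; c \<in> carrier H\<rbrakk> \<Longrightarrow> tern H a b c = tern H c b a"

definition sub_heap :: "'a set \<Rightarrow> ('a, 'x) heap_scheme \<Rightarrow> bool" where
  "sub_heap P H \<longleftrightarrow>
    P \<subseteq> carrier H \<and> (\<forall>a\<in>P. \<forall>b\<in>P. \<forall>c\<in>P. tern H a b c \<in> P)"

definition sub_heap_rel :: "('a, 'x) heap_scheme \<Rightarrow> 'a set \<Rightarrow> ('a \<times> 'a) set" where
  "sub_heap_rel H P =
    {(x, y). x \<in> carrier H \<and> y \<in> carrier H \<and> (\<exists>p\<in>P. tern H x y p \<in> P)}"

text \<open>
  Operations on quotients are given as the union of the classes of all results obtained from
  representatives. This union is a single class exactly when the operation on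
  representatives is compatible with the relation.
\<close>

definition quot_tern ::
  "('a, 'x) heap_scheme \<Rightarrow> 'a set \<Rightarrow> 'a set \<Rightarrow> 'a set \<Rightarrow> 'a set \<Rightarrow> 'a set" where
  "quot_tern H P A B C =
    (\<Union>a\<in>A. \<Union>b\<in>B. \<Union>c\<in>C. sub_heap_rel H P `` {tern H a b c})"


section \<open>Trusses\<close>

record 'a truss = "'a heap" +
  tmult :: "'a \<Rightarrow> 'a \<Rightarrow> 'a"

locale truss = abelian_heap T for T (structure) +
  assumes tmult_closed:
      "\<lbrakk>a \<in> carrier T; b \<in> carrier T\<rbrakk> \<Longrightarrow> tmult T a b \<in> carrier T"
    and tmult_assoc:
      "\<lbrakk>a \<in> carrier T; b \<in> carrier T; c \<in> carrier T\<rbrakk>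
        \<Longrightarrow> tmult T (tmult T a b) c = tmult T a (tmult T b c)"
    and tmult_tern_distrib_left:
      "\<lbrakk>a \<in> carrier T; b \<in> carrier T; c \<in> carrier T; d \<in> carrier T\<rbrakk>
        \<Longrightarrow> tmult T a (tern T b c d) = tern T (tmult T a b) (tmult T a c) (tmult T a d)"
    and tmult_tern_distrib_right:
      "\<lbrakk>a \<in> carrier T; b \<in> carrier T; c \<in> carrier T; d \<in> carrier T\<rbrakk>
        \<Longrightarrow> tmult T (tern T b c d) a = tern T (tmult T b a) (tmult T c a) (tmult T d a)"

definition truss_isomorphic ::
  "('a, 'x) truss_scheme \<Rightarrow> ('b, 'y) truss_scheme \<Rightarrow> bool" where
  "truss_isomorphic S T \<longleftrightarrow> truss S \<and> truss T \<and>
    (\<exists>h. bij_betw h (carrier S) (carrier T) \<and>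
      (\<forall>a\<in>carrier S. \<forall>b\<in>carrier S. \<forall>c\<in>carrier S.
        h (tern S a b c) = tern T (h a) (h b) (h c)) \<and>
      (\<forall>a\<in>carrier S. \<forall>b\<in>carrier S. h (tmult S a b) = tmult T (h a) (h b)))"

definition is_identity :: "('a, 'x) truss_scheme \<Rightarrow> 'a \<Rightarrow> bool" where
  "is_identity T u \<longleftrightarrow>
    u \<in> carrier T \<and> (\<forall>t\<in>carrier T. tmult T u t = t \<and> tmult T t u = t)"

definition unital_truss :: "('a, 'x) truss_scheme \<Rightarrow> bool" where
  "unital_truss T \<longleftrightarrow> truss T \<and> (\<exists>u. is_identity T u)"

text \<open>For a truss that is not unital, the following set is empty.\<close>

definition truss_units :: "('a, 'x) truss_scheme \<Rightarrow> 'a set" where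
  "truss_units T =
    {x \<in> carrier T. \<exists>y\<in>carrier T. \<exists>u. is_identity T u \<and> tmult T x y = u \<and> tmult T y x = u}"

definition sub_truss :: "'a set \<Rightarrow> ('a, 'x) truss_scheme \<Rightarrow> bool" where
  "sub_truss S T \<longleftrightarrow> sub_heap S T \<and> (\<forall>a\<in>S. \<forall>b\<in>S. tmult T a b \<in> S)"

definition truss_absorber :: "('a, 'x) truss_scheme \<Rightarrow> 'a \<Rightarrow> bool" where
  "truss_absorber T z \<longleftrightarrow>
    z \<in> carrier T \<and> (\<forall>t\<in>carrier T. tmult T z t = z \<and> tmult T t z = z)"

definition truss_ideal :: "'a set \<Rightarrow> ('a, 'x) truss_scheme \<Rightarrow> bool" where
  "truss_ideal J T \<longleftrightarrow>
    sub_heap J T \<and> (\<forall>t\<in>carrier T. \<forall>x\<in>J. tmult T t x \<in> J \<and> tmult T x t \<in> J)"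

definition left_paragon :: "'a set \<Rightarrow> ('a, 'x) truss_scheme \<Rightarrow> bool" where
  "left_paragon P T \<longleftrightarrow> sub_heap P T \<and>
    (\<exists>q\<in>P. \<forall>x\<in>carrier T. \<forall>p\<in>P. tern T (tmult T x p) (tmult T x q) q \<in> P)"

definition paragon :: "'a set \<Rightarrow> ('a, 'x) truss_scheme \<Rightarrow> bool" where
  "paragon P T \<longleftrightarrow> sub_heap P T \<and>
    (\<exists>q\<in>P. \<forall>x\<in>carrier T. \<forall>p\<in>P.
      tern T (tmult T x p) (tmult T x q) q \<in> P \<and>
      tern T (tmult T p x) (tmult T q x) q \<in> P)"

definition quot_truss :: "('a, 'x) truss_scheme \<Rightarrow> 'a set \<Rightarrow> 'a set truss" where
  "quot_truss T P =
    \<lparr>carrier = carrier T // sub_heap_rel T P,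
     tern = quot_tern T P,
     tmult = (\<lambda>A B. \<Union>a\<in>A. \<Union>b\<in>B. sub_heap_rel T P `` {tmult T a b})\<rparr>"


section \<open>Modules over trusses\<close>

record ('t, 'm) tmodule = "'m heap" +
  act :: "'t \<Rightarrow> 'm \<Rightarrow> 'm"

locale left_tmodule = truss T + M: abelian_heap M for T (structure) and M (structure) +
  assumes act_closed:
      "\<lbrakk>t \<in> carrier T; m \<in> carrier M\<rbrakk> \<Longrightarrow> act M t m \<in> carrier M"
    and act_assoc:
      "\<lbrakk>t \<in> carrier T; t' \<in> carrier T; m \<in> carrier M\<rbrakk>
        \<Longrightarrow> act M t (act M t' m) = act M (tmult T t t') m"
    and act_tern_left:
      "\<lbrakk>t \<in> carrier T; t' \<in> carrier T; t'' \<in> carrier T; m \<in> carrier M\<rbrakk>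
        \<Longrightarrow> act M (tern T t t' t'') m = tern M (act M t m) (act M t' m) (act M t'' m)"
    and act_tern_right:
      "\<lbrakk>t \<in> carrier T; m \<in> carrier M; m' \<in> carrier M; m'' \<in> carrier M\<rbrakk>
        \<Longrightarrow> act M t (tern M m m' m'') = tern M (act M t m) (act M t m') (act M t m'')"

definition unital_tmodule ::
  "('t, 'x) truss_scheme \<Rightarrow> ('t, 'm, 'y) tmodule_scheme \<Rightarrow> bool" where
  "unital_tmodule T M \<longleftrightarrow> left_tmodule T M \<and>
    (\<exists>u. is_identity T u \<and> (\<forall>m\<in>carrier M. act M u m = m))"

definition tmodule_absorber ::
  "('t, 'x) truss_scheme \<Rightarrow> ('t, 'm, 'y) tmodule_scheme \<Rightarrow> 'm \<Rightarrow> bool" where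
  "tmodule_absorber T M z \<longleftrightarrow> z \<in> carrier M \<and> (\<forall>t\<in>carrier T. act M t z = z)"

definition induced_act :: "('t, 'm, 'y) tmodule_scheme \<Rightarrow> 'm \<Rightarrow> 't \<Rightarrow> 'm \<Rightarrow> 'm" where
  "induced_act M z t m = tern M (act M t m) (act M t z) z"

definition tmodule_isomorphic ::
  "('t, 'x) truss_scheme \<Rightarrow> ('t, 'm, 'y) tmodule_scheme \<Rightarrow> ('t, 'n, 'z) tmodule_scheme \<Rightarrow> bool"
  where
  "tmodule_isomorphic T M N \<longleftrightarrow> left_tmodule T M \<and> left_tmodule T N \<and>
    (\<exists>h. bij_betw h (carrier M) (carrier N) \<and>
      (\<forall>a\<in>carrier M. \<forall>b\<in>carrier M. \<forall>c\<in>carrier M.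
        h (tern M a b c) = tern N (h a) (h b) (h c)) \<and>
      (\<forall>t\<in>carrier T. \<forall>m\<in>carrier M. h (act M t m) = act N t (h m)))"

definition quot_tmodule :: "('a, 'x) truss_scheme \<Rightarrow> 'a set \<Rightarrow> ('a, 'a set) tmodule" where
  "quot_tmodule T P =
    \<lparr>carrier = carrier T // sub_heap_rel T P,
     tern = quot_tern T P,
     act = (\<lambda>t A. \<Union>a\<in>A. sub_heap_rel T P `` {tmult T t a})\<rparr>"


section \<open>The truss \<open>T[M;e]\<close> and its action on \<open>M\<close>\<close>

definition ext_truss ::
  "('t, 'x) truss_scheme \<Rightarrow> ('t, 'm, 'y) tmodule_scheme \<Rightarrow> 'm \<Rightarrow> ('t \<times> 'm) truss" where
  "ext_truss T M e =
    \<lparr>carrier = carrier T \<times> carrier M,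
     tern = (\<lambda>(t, m) (t', m') (t'', m''). (tern T t t' t'', tern M m m' m'')),
     tmult = (\<lambda>(t, m) (t', m'). (tmult T t t', tern M m (act M t e) (act M t m')))\<rparr>"

definition ext_tmodule ::
  "('t, 'm, 'y) tmodule_scheme \<Rightarrow> 'm \<Rightarrow> ('t \<times> 'm, 'm) tmodule" where
  "ext_tmodule M e =
    \<lparr>carrier = carrier M,
     tern = tern M,
     act = (\<lambda>(t, m) m'. tern M m (act M t e) (act M t m'))\<rparr>"

end

(*
  The translation m \<mapsto> [m, t e, t e'] in the fibre over t identifies T[M;e] with T[M;e'].
  The sub-heap relations of {a} \<times> M and T \<times> {e} are the kernels of the two projections
  of T \<times> M, which are a truss homomorphism to T and a module homomorphism to M, so both
  quotients are read off from their fibres. An identity of T[M;e] can only be (1, e), and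
  (t, m) with t invertible has the inverse (s, [s e, s m, e]), where s is the inverse of t.
*)
theory Submission
  imports Defs
begin

section \<open>Identities in heaps and abelian heaps\<close>

context heap
begin

text \<open>Applying [-, p, y] undoes the bracket. When P is a fibre of a projection, this turns its
  sub-heap relation into equality of projections.\<close>

lemma tern_eq_right_iff:
  assumes "x \<in> carrier H" "y \<in> carrier H" "p \<in> carrier H"
  shows "tern H x y p = p \<longleftrightarrow> x = y"
proof
  assume "tern H x y p = p"
  then have "tern H (tern H x y p) p y = tern H p p y" by simp
  with assms show "x = y" by (simp add: tern_assoc tern_left_cancel tern_right_cancel)
qed (use assms in \<open>simp add: tern_left_cancel\<close>)

text \<open>With [a, b, c] read as a b^-1 c in a group, this is the rule for inverting a product; it
  needs no commutativity.\<close>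

lemma tern_mid:
  assumes "a \<in> carrier H" "b \<in> carrier H" "c \<in> carrier H" "d \<in> carrier H" "f \<in> carrier H"
  shows "tern H a (tern H b c d) f = tern H a d (tern H c b f)"
proof -
  let ?x = "tern H b c d"
  have x: "?x \<in> carrier H" using assms by (simp add: tern_closed)
  have "tern H ?x d c = b" using assms by (simp add: tern_assoc tern_left_cancel tern_right_cancel)
  then have "tern H a ?x b = tern H (tern H a ?x ?x) d c"
    using assms x by (simp only: tern_assoc)
  also have "\<dots> = tern H a d c" using assms x by (simp add: tern_right_cancel)
  finally have "tern H (tern H a ?x b) b f = tern H (tern H a d c) b f" by simp
  with assms x show ?thesis by (simp add: tern_assoc[of a] tern_left_cancel)
qed

end

context abelian_heap
begin

lemma tern_left_commute:
  assumes "a \<in> carrier H" "b \<in> carrier H" "c \<in> carrier H" "d \<in> carrier H" "f \<in> carrier H"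
  shows "tern H a b (tern H c d f) = tern H c b (tern H a d f)"
  using assms by (metis tern_assoc tern_comm)

lemma tern_mid_commute:
  assumes "a \<in> carrier H" "b \<in> carrier H" "c \<in> carrier H" "d \<in> carrier H" "f \<in> carrier H"
  shows "tern H a b (tern H c d f) = tern H a d (tern H c b f)"
  using assms by (metis tern_mid tern_comm)

text \<open>Together these nest an expression to the right and permute the entries of each sign
  among themselves.\<close>

lemmas tern_ac = tern_assoc tern_mid tern_comm tern_left_commute tern_mid_commute

text \<open>With [a, b, c] read as a - b + c, both sides are the same signed sum of nine
  entries.\<close>

lemma tern_medial:
  assumes "a \<in> carrier H" "b \<in> carrier H" "c \<in> carrier H"
    "a' \<in> carrier H" "b' \<in> carrier H" "c' \<in> carrier H"
    "a'' \<in> carrier H" "b'' \<in> carrier H" "c'' \<in> carrier H"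
  shows "tern H (tern H a b c) (tern H a' b' c') (tern H a'' b'' c'') =
    tern H (tern H a a' a'') (tern H b b' b'') (tern H c c' c'')"
  using assms by (simp add: tern_closed tern_ac)

text \<open>Mediality with two constant columns: the translation x -> [a, b, x] respects the
  bracket.\<close>

lemma tern_translate:
  assumes "a \<in> carrier H" "b \<in> carrier H" "c \<in> carrier H" "d \<in> carrier H" "f \<in> carrier H"
  shows "tern H (tern H a b c) (tern H a b d) (tern H a b f) = tern H a b (tern H c d f)"
  using assms tern_medial[of a b c a b d a b f] by (simp add: tern_left_cancel)

lemma tern_translate':
  assumes "a \<in> carrier H" "b \<in> carrier H" "c \<in> carrier H" "d \<in> carrier H" "f \<in> carrier H"
  shows "tern H (tern H a b c) (tern H a b d) f = tern H c d f"
proof -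
  \<comment> \<open>With both translations written in reverse, expansion makes the two entries a
    adjacent, and they cancel.\<close>
  have "tern H (tern H c b a) (tern H d b a) f = tern H c b (tern H b d f)"
    using assms by (simp add: tern_closed tern_mid tern_assoc tern_left_cancel)
  also have "\<dots> = tern H c d f"
    using assms tern_assoc[of c b b d f] by (simp add: tern_right_cancel)
  finally show ?thesis using assms by (simp add: tern_comm[of a b])
qed

end

section \<open>Transport of structure along a bijection\<close>

text \<open>Meant for quotients: with \<open>g\<close> parametrizing the classes by a known truss,
  the axioms are inherited and need not be checked on classes.\<close>

lemma truss_transport:
  assumes S: "truss S" and bij: "bij_betw g (carrier S) (carrier Q)"
    and tern: "\<And>a b c. \<lbrakk>a \<in> carrier S; b \<in> carrier S; c \<in> carrier S\<rbrakk>
      \<Longrightarrow> tern Q (g a) (g b) (g c) = g (tern S a b c)"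
    and mult: "\<And>a b. \<lbrakk>a \<in> carrier S; b \<in> carrier S\<rbrakk> \<Longrightarrow> tmult Q (g a) (g b) = g (tmult S a b)"
  shows "truss_isomorphic Q S"
proof -
  interpret truss S by fact
  note closed = tern_closed tmult_closed
  have Q: "carrier Q = g ` carrier S" using bij by (simp add: bij_betw_def)
  have "truss Q"
    by unfold_locales
      (auto simp: Q tern mult closed tern_assoc tern_left_cancel tern_right_cancel tmult_assoc
        tmult_tern_distrib_left tmult_tern_distrib_right intro: arg_cong[where f = g, OF tern_comm])
  moreover have "the_inv_into (carrier S) g (g a) = a" if "a \<in> carrier S" for a
    using bij that by (simp add: bij_betw_def the_inv_into_f_f)
  ultimately show ?thesis
    unfolding truss_isomorphic_def using S bij_betw_the_inv_into[OF bij]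
    by (intro conjI exI[of _ "the_inv_into (carrier S) g"])
      (auto simp: Q tern mult closed)
qed

lemma tmodule_transport:
  assumes M: "left_tmodule T M" and bij: "bij_betw g (carrier M) (carrier Q)"
    and tern: "\<And>a b c. \<lbrakk>a \<in> carrier M; b \<in> carrier M; c \<in> carrier M\<rbrakk>
      \<Longrightarrow> tern Q (g a) (g b) (g c) = g (tern M a b c)"
    and act: "\<And>t m. \<lbrakk>t \<in> carrier T; m \<in> carrier M\<rbrakk> \<Longrightarrow> act Q t (g m) = g (act M t m)"
  shows "tmodule_isomorphic T Q M"
proof -
  interpret left_tmodule T M by fact
  note closed = tern_closed M.tern_closed tmult_closed act_closed
  have Q: "carrier Q = g ` carrier M" using bij by (simp add: bij_betw_def)
  have "left_tmodule T Q"
    by unfold_locales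
      (auto simp: Q tern act closed M.tern_assoc M.tern_left_cancel M.tern_right_cancel act_assoc
        act_tern_left act_tern_right intro: arg_cong[where f = g, OF M.tern_comm])
  moreover have "the_inv_into (carrier M) g (g a) = a" if "a \<in> carrier M" for a
    using bij that by (simp add: bij_betw_def the_inv_into_f_f)
  ultimately show ?thesis
    unfolding tmodule_isomorphic_def using M bij_betw_the_inv_into[OF bij]
    by (intro conjI exI[of _ "the_inv_into (carrier M) g"])
      (auto simp: Q tern act closed)
qed

section \<open>Quotients by the kernel of a surjective homomorphism\<close>

lemma bij_betw_fibres:
  assumes "f ` A = B" and r: "r = {(x, y). x \<in> A \<and> y \<in> A \<and> f x = f y}"
  shows "bij_betw (\<lambda>b. {x \<in> A. f x = b}) B (A // r)"
proof -
  have "A // r = (\<lambda>b. {x \<in> A. f x = b}) ` f ` A"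
    unfolding quotient_def r by force
  \<comment> \<open>Fibres over points of the image are non-empty, so each determines its
    point.\<close>
  moreover have "inj_on (\<lambda>b. {x \<in> A. f x = b}) (f ` A)"
    by (rule inj_onI) blast
  ultimately show ?thesis using assms(1) by (simp add: bij_betw_def)
qed

text \<open>The image of a result under \<open>f\<close> depends only on u, v and w, so all classes
  in the union defining \<open>quot_tern\<close> coincide.\<close>

lemma quot_tern_fibres:
  assumes "heap S" and sur: "f ` carrier S = carrier H"
    and tern: "\<And>a b c. \<lbrakk>a \<in> carrier S; b \<in> carrier S; c \<in> carrier S\<rbrakk>
      \<Longrightarrow> f (tern S a b c) = tern H (f a) (f b) (f c)"
    and rel: "sub_heap_rel S P = {(x, y). x \<in> carrier S \<and> y \<in> carrier S \<and> f x = f y}"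
    and "u \<in> carrier H" "v \<in> carrier H" "w \<in> carrier H"
  shows "quot_tern S P {x \<in> carrier S. f x = u} {x \<in> carrier S. f x = v} {x \<in> carrier S. f x = w}
    = {x \<in> carrier S. f x = tern H u v w}"
proof -
  interpret heap S by fact
  \<comment> \<open>Surjectivity supplies representatives; without them the union would be
    empty.\<close>
  obtain a b c where "a \<in> carrier S" "b \<in> carrier S" "c \<in> carrier S" "f a = u" "f b = v" "f c = w"
    using assms(5-7) unfolding sur[symmetric] by blast
  then show ?thesis
    unfolding quot_tern_def rel by (auto simp: tern_closed tern)
qed

text \<open>First isomorphism theorem: sending t to its fibre carries the structure of
  \<open>T\<close> over to the quotient.\<close>

lemma quot_truss_isomorphic:
  assumes S: "truss S" and T: "truss T" and sur: "f ` carrier S = carrier T"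
    and tern: "\<And>a b c. \<lbrakk>a \<in> carrier S; b \<in> carrier S; c \<in> carrier S\<rbrakk>
      \<Longrightarrow> f (tern S a b c) = tern T (f a) (f b) (f c)"
    and mult: "\<And>a b. \<lbrakk>a \<in> carrier S; b \<in> carrier S\<rbrakk> \<Longrightarrow> f (tmult S a b) = tmult T (f a) (f b)"
    and rel: "sub_heap_rel S P = {(x, y). x \<in> carrier S \<and> y \<in> carrier S \<and> f x = f y}"
  shows "truss_isomorphic (quot_truss S P) T"
proof (rule truss_transport[OF T, where g = "\<lambda>t. {x \<in> carrier S. f x = t}"])
  interpret S: truss S by fact
  show "bij_betw (\<lambda>t. {x \<in> carrier S. f x = t}) (carrier T) (carrier (quot_truss S P))"
    using bij_betw_fibres[OF sur rel] by (simp add: quot_truss_def)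
  show "tern (quot_truss S P) {x \<in> carrier S. f x = a} {x \<in> carrier S. f x = b}
      {x \<in> carrier S. f x = c} = {x \<in> carrier S. f x = tern T a b c}"
    if "a \<in> carrier T" "b \<in> carrier T" "c \<in> carrier T" for a b c
    using quot_tern_fibres[where f=f and H=T, OF S.heap_axioms sur tern rel that]
    by (simp add: quot_truss_def)
  show "tmult (quot_truss S P) {x \<in> carrier S. f x = u} {x \<in> carrier S. f x = v} =
      {x \<in> carrier S. f x = tmult T u v}"
    if prems: "u \<in> carrier T" "v \<in> carrier T" for u v
  proof -
    obtain a b where "a \<in> carrier S" "b \<in> carrier S" "f a = u" "f b = v"
      using prems unfolding sur[symmetric] by blast
    then show ?thesis
      unfolding quot_truss_def rel by (auto simp: S.tmult_closed mult)
  qed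
qed

lemma quot_tmodule_isomorphic:
  assumes S: "truss S" and M: "left_tmodule S M" and sur: "f ` carrier S = carrier M"
    and tern: "\<And>a b c. \<lbrakk>a \<in> carrier S; b \<in> carrier S; c \<in> carrier S\<rbrakk>
      \<Longrightarrow> f (tern S a b c) = tern M (f a) (f b) (f c)"
    and act: "\<And>t a. \<lbrakk>t \<in> carrier S; a \<in> carrier S\<rbrakk> \<Longrightarrow> f (tmult S t a) = act M t (f a)"
    and rel: "sub_heap_rel S P = {(x, y). x \<in> carrier S \<and> y \<in> carrier S \<and> f x = f y}"
  shows "tmodule_isomorphic S (quot_tmodule S P) M"
proof (rule tmodule_transport[OF M, where g = "\<lambda>m. {x \<in> carrier S. f x = m}"])
  interpret S: truss S by fact
  show "bij_betw (\<lambda>m. {x \<in> carrier S. f x = m}) (carrier M) (carrier (quot_tmodule S P))"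
    using bij_betw_fibres[OF sur rel] by (simp add: quot_tmodule_def)
  show "tern (quot_tmodule S P) {x \<in> carrier S. f x = a} {x \<in> carrier S. f x = b}
      {x \<in> carrier S. f x = c} = {x \<in> carrier S. f x = tern M a b c}"
    if "a \<in> carrier M" "b \<in> carrier M" "c \<in> carrier M" for a b c
    using quot_tern_fibres[where f=f and H=M, OF S.heap_axioms sur tern rel that]
    by (simp add: quot_tmodule_def)
  show "act (quot_tmodule S P) t {x \<in> carrier S. f x = m} = {x \<in> carrier S. f x = act M t m}"
    if prems: "t \<in> carrier S" "m \<in> carrier M" for t m
  proof -
    obtain a where "a \<in> carrier S" "f a = m"
      using prems unfolding sur[symmetric] by blast
    then show ?thesis
      unfolding quot_tmodule_def rel using prems by (auto simp: S.tmult_closed act)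
  qed
qed

section \<open>The truss T[M;e] and its action on M\<close>

lemma ext_truss_simps [simp]:
  "carrier (ext_truss T M e) = carrier T \<times> carrier M"
  "tern (ext_truss T M e) (t, m) (t', m') (t'', m'') = (tern T t t' t'', tern M m m' m'')"
  "tmult (ext_truss T M e) (t, m) (t', m') = (tmult T t t', tern M m (act M t e) (act M t m'))"
  by (simp_all add: ext_truss_def)

lemma ext_tmodule_simps [simp]:
  "carrier (ext_tmodule M e) = carrier M"
  "tern (ext_tmodule M e) = tern M"
  "act (ext_tmodule M e) (t, m) m' = tern M m (act M t e) (act M t m')"
  by (simp_all add: ext_tmodule_def)

context left_tmodule
begin

lemmas closed = tern_closed tmult_closed M.tern_closed act_closed
lemmas cancel = tern_left_cancel tern_right_cancel M.tern_left_cancel M.tern_right_cancel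

text \<open>The second component of a product is the left factor acting on the second component of
  the right factor. So this identity gives associativity of the multiplication and, read backwards,
  the action law; the two distributive laws below serve twice in the same way.\<close>

lemma ext_assoc:
  assumes "e \<in> carrier M" "t \<in> carrier T" "t' \<in> carrier T"
    "n \<in> carrier M" "n' \<in> carrier M" "m \<in> carrier M"
  shows "tern M (tern M n (act M t e) (act M t n')) (act M (tmult T t t') e) (act M (tmult T t t') m)
    = tern M n (act M t e) (act M t (tern M n' (act M t' e) (act M t' m)))"
  using assms by (simp add: closed M.tern_assoc act_assoc act_tern_right)

text \<open>The map x -> [n, t e, t x] is the action of t followed by a translation, and both
  respect the bracket.\<close>

lemma ext_distrib_left:
  assumes "e \<in> carrier M" "t \<in> carrier T"
    "n \<in> carrier M" "m \<in> carrier M" "m' \<in> carrier M" "m'' \<in> carrier M"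
  shows "tern M n (act M t e) (act M t (tern M m m' m'')) =
    tern M (tern M n (act M t e) (act M t m)) (tern M n (act M t e) (act M t m'))
      (tern M n (act M t e) (act M t m''))"
  using assms by (simp add: closed act_tern_right M.tern_translate)

lemma ext_distrib_right:
  assumes "e \<in> carrier M" "t \<in> carrier T" "t' \<in> carrier T" "t'' \<in> carrier T"
    "n \<in> carrier M" "n' \<in> carrier M" "n'' \<in> carrier M" "m \<in> carrier M"
  shows "tern M (tern M n n' n'') (act M (tern T t t' t'') e) (act M (tern T t t' t'') m) =
    tern M (tern M n (act M t e) (act M t m)) (tern M n' (act M t' e) (act M t' m))
      (tern M n'' (act M t'' e) (act M t'' m))"
  using assms M.tern_medial by (simp add: closed act_tern_left)

lemma ext_truss_is_truss:
  assumes "e \<in> carrier M"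
  shows "truss (ext_truss T M e)"
  by unfold_locales
    (use assms in \<open>auto simp: closed cancel tern_assoc tmult_assoc tmult_tern_distrib_left
      tmult_tern_distrib_right intro!: tern_comm M.tern_comm M.tern_assoc ext_assoc
      ext_distrib_left ext_distrib_right\<close>)

lemma ext_truss_isomorphic:
  assumes e: "e \<in> carrier M" and e': "e' \<in> carrier M"
  shows "truss_isomorphic (ext_truss T M e) (ext_truss T M e')"
proof -
  \<comment> \<open>Both base points are arguments because \<open>h e' e\<close> is the inverse of
    \<open>h e e'\<close>.\<close>
  define h where "h e e' = (\<lambda>(t, m). (t, tern M m (act M t e) (act M t e')))" for e e'
  have "bij_betw (h e e') (carrier T \<times> carrier M) (carrier T \<times> carrier M)"
    by (rule bij_betw_byWitness[where f' = "h e' e"])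
      (use e e' in \<open>auto simp: h_def closed cancel M.tern_assoc\<close>)
  moreover have "h e e' (tern (ext_truss T M e) x y z) =
      tern (ext_truss T M e') (h e e' x) (h e e' y) (h e e' z)"
    if "x \<in> carrier T \<times> carrier M" "y \<in> carrier T \<times> carrier M" "z \<in> carrier T \<times> carrier M" for x y z
    using that e e' by (auto simp: h_def closed act_tern_left intro!: M.tern_medial)
  \<comment> \<open>On the right, the t e' introduced by \<open>h\<close> cancels against the t e'
    in the multiplication of T[M;e'].\<close>
  moreover have "h e e' (tmult (ext_truss T M e) x y) =
      tmult (ext_truss T M e') (h e e' x) (h e e' y)"
    if "x \<in> carrier T \<times> carrier M" "y \<in> carrier T \<times> carrier M" for x y
    using that e e'
    by (auto simp: h_def closed cancel act_tern_right act_assoc M.tern_assoc)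
  ultimately show ?thesis
    unfolding truss_isomorphic_def
    using ext_truss_is_truss[OF e] ext_truss_is_truss[OF e'] by auto
qed

lemma ext_tmodule_is_tmodule:
  assumes "e \<in> carrier M"
  shows "left_tmodule (ext_truss T M e) (ext_tmodule M e)"
proof -
  interpret E: truss "ext_truss T M e" by (rule ext_truss_is_truss[OF assms])
  show ?thesis
    by unfold_locales
      (use assms in \<open>auto simp: closed cancel intro!: M.tern_comm M.tern_assoc ext_assoc[symmetric]
        ext_distrib_left ext_distrib_right\<close>)
qed

text \<open>Both t m' and t z are shifted by the same translation [m, t e, -], which cancels in the
  difference.\<close>

lemma induced_act_ext_tmodule:
  assumes "e \<in> carrier M" "z \<in> carrier M" "t \<in> carrier T" "m \<in> carrier M" "m' \<in> carrier M"
  shows "induced_act (ext_tmodule M e) z (t, m) m' = induced_act M z t m'"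
  using assms by (simp add: induced_act_def M.tern_translate' closed)

lemma induced_act_absorber:
  assumes "tmodule_absorber T M z" "t \<in> carrier T" "m \<in> carrier M"
  shows "induced_act M z t m = act M t m"
  using assms by (simp add: induced_act_def tmodule_absorber_def closed cancel)

section \<open>The sub-heaps over a point of T and over e, and their quotients\<close>

lemma paragon_fibre:
  assumes "e \<in> carrier M" "a \<in> carrier T"
  shows "paragon ({a} \<times> carrier M) (ext_truss T M e)"
  \<comment> \<open>For q = (a, e), the first components of x p and x q agree, as do those of p x
    and q x, so a remains.\<close>
  unfolding paragon_def sub_heap_def
  using assms by (auto simp: closed cancel intro!: bexI[of _ "(a, e)"])

lemma quot_truss_fibre_isomorphic:
  assumes "e \<in> carrier M" "a \<in> carrier T"
  shows "truss_isomorphic (quot_truss (ext_truss T M e) ({a} \<times> carrier M)) T"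
proof (rule quot_truss_isomorphic[where f = fst])
  \<comment> \<open>The relation amounts to [fst x, fst y, a] = a; the base point e completes the
    witness.\<close>
  show "sub_heap_rel (ext_truss T M e) ({a} \<times> carrier M) = {(x, y).
      x \<in> carrier (ext_truss T M e) \<and> y \<in> carrier (ext_truss T M e) \<and> fst x = fst y}"
    unfolding sub_heap_rel_def using assms
    by (auto simp: closed tern_eq_right_iff tern_left_cancel intro!: bexI[of _ "(a, e)"])
qed (use assms ext_truss_is_truss truss_axioms in auto)

text \<open>Only first components matter. The point e keeps the fibre from being empty and thus
  trivially an ideal.\<close>

lemma truss_ideal_fibre_iff:
  assumes "e \<in> carrier M" "a \<in> carrier T"
  shows "truss_ideal ({a} \<times> carrier M) (ext_truss T M e) \<longleftrightarrow> truss_absorber T a"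
  unfolding truss_ideal_def truss_absorber_def sub_heap_def
  using assms by (auto simp: closed cancel)

lemma sub_truss_section:
  assumes "e \<in> carrier M"
  shows "sub_truss (carrier T \<times> {e}) (ext_truss T M e)"
  unfolding sub_truss_def sub_heap_def
  using assms by (auto simp: closed cancel)

text \<open>A left paragon contains its q, so \<open>T\<close> must be inhabited. For x = (t, n),
  both x p and x q have second component n, and [n, n, e] = e.\<close>

lemma left_paragon_section:
  assumes "e \<in> carrier M" "carrier T \<noteq> {}"
  shows "left_paragon (carrier T \<times> {e}) (ext_truss T M e)"
proof -
  obtain a where "a \<in> carrier T" using assms by blast
  then show ?thesis
    unfolding left_paragon_def sub_heap_def
    using assms by (auto simp: closed cancel intro!: bexI[of _ "(a, e)"])
qed

text \<open>Under \<open>snd\<close>, left multiplication becomes the action on M. An element of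
  \<open>T\<close> makes \<open>snd\<close> surjective and completes the witness for the sub-heap
  relation.\<close>

lemma quot_tmodule_section_isomorphic:
  assumes "e \<in> carrier M" "carrier T \<noteq> {}"
  shows "tmodule_isomorphic (ext_truss T M e)
    (quot_tmodule (ext_truss T M e) (carrier T \<times> {e})) (ext_tmodule M e)"
proof (rule quot_tmodule_isomorphic[where f = snd])
  obtain a where "a \<in> carrier T" using assms by blast
  then show "sub_heap_rel (ext_truss T M e) (carrier T \<times> {e}) = {(x, y).
      x \<in> carrier (ext_truss T M e) \<and> y \<in> carrier (ext_truss T M e) \<and> snd x = snd y}"
    unfolding sub_heap_rel_def using assms
    by (auto simp: closed M.tern_eq_right_iff M.tern_left_cancel intro!: bexI[of _ "(a, e)"])
qed (use assms ext_truss_is_truss ext_tmodule_is_tmodule in auto)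

section \<open>Identities and units\<close>

lemma is_identity_ext_truss_iff:
  assumes e: "e \<in> carrier M"
  shows "is_identity (ext_truss T M e) (u, n) \<longleftrightarrow>
    is_identity T u \<and> n = e \<and> (\<forall>m\<in>carrier M. act M u m = m)"
proof
  assume id: "is_identity (ext_truss T M e) (u, n)"
  then have u: "u \<in> carrier T" and n: "n \<in> carrier M" and uT: "is_identity T u"
    using e by (auto simp: is_identity_def)
  have left: "tern M n (act M u e) (act M u m) = m" if "m \<in> carrier M" for m
    using id u that by (auto simp: is_identity_def)
  \<comment> \<open>At m = e the bracket [n, u e, u e] collapses to n.\<close>
  from left[OF e] have ne: "n = e" using n u e by (simp add: closed cancel)
  \<comment> \<open>By \<open>left\<close>, the action of \<open>u\<close> is a translation; being idempotent, it is trivial.\<close>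
  have "act M u m = m" if m: "m \<in> carrier M" for m
  proof -
    have "act M u (act M u m) = act M u m"
      using uT u m by (simp add: act_assoc is_identity_def)
    with left[OF act_closed[OF u m]] left[OF m] show ?thesis by simp
  qed
  with uT ne show "is_identity T u \<and> n = e \<and> (\<forall>m\<in>carrier M. act M u m = m)" by blast
next
  assume "is_identity T u \<and> n = e \<and> (\<forall>m\<in>carrier M. act M u m = m)"
  with e show "is_identity (ext_truss T M e) (u, n)"
    by (auto simp: is_identity_def closed cancel)
qed

lemma unital_ext_truss_iff:
  assumes e: "e \<in> carrier M"
  shows "unital_truss (ext_truss T M e) \<longleftrightarrow> unital_tmodule T M"
  using is_identity_ext_truss_iff[OF e] ext_truss_is_truss[OF e] left_tmodule_axioms
  unfolding unital_truss_def unital_tmodule_def by (metis surj_pair)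

text \<open>Unitality of T[M;e] is a genuine condition: if \<open>T\<close> is unital but M is not,
  the left side is empty while the right side contains (1, e).\<close>

lemma truss_units_ext_truss:
  assumes e: "e \<in> carrier M" and unital: "unital_truss (ext_truss T M e)"
  shows "truss_units (ext_truss T M e) = truss_units T \<times> carrier M"
proof -
  obtain u where u: "is_identity T u" "\<And>m. m \<in> carrier M \<Longrightarrow> act M u m = m"
    using unital unital_ext_truss_iff[OF e] by (auto simp: unital_tmodule_def)
  \<comment> \<open>Identities are unique, so the existential one in \<open>truss_units\<close> can
    be replaced by a fixed one.\<close>
  have id_T: "is_identity T v \<longleftrightarrow> v = u" for v
    using u(1) by (metis is_identity_def)
  have id: "is_identity (ext_truss T M e) w \<longleftrightarrow> w = (u, e)" for w
    by (cases w) (auto simp: is_identity_ext_truss_iff[OF e] id_T u(2))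
  have "(t, m) \<in> truss_units (ext_truss T M e)" if t_unit: "t \<in> truss_units T" and m: "m \<in> carrier M" for t m
  proof -
    obtain s where t: "t \<in> carrier T" and s: "s \<in> carrier T"
      and ts: "tmult T t s = u" and st: "tmult T s t = u"
      using t_unit by (auto simp: truss_units_def id_T)
    \<comment> \<open>This \<open>n\<close> solves [n, s e, s m] = e, the second component of (s,
      n)(t, m) = (u, e).\<close>
    define n where "n = tern M (act M s e) (act M s m) e"
    have n: "n \<in> carrier M" using s m e by (simp add: n_def closed)
    \<comment> \<open>Here t s = u acts trivially; exchanging t e and m in [m, t e, [e, m, t e]]
      then leaves e.\<close>
    have "act M t n = tern M e m (act M t e)"
      using t s m e ts u by (simp add: n_def closed act_tern_right act_assoc)
    then have "tern M m (act M t e) (act M t n) = e"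
      using t m e M.tern_mid_commute[of m "act M t e" e m "act M t e"] by (simp add: closed cancel)
    moreover have "tern M n (act M s e) (act M s m) = e"
      using M.tern_comm[of "act M s e" "act M s m" e] s m e
      by (simp add: n_def closed cancel M.tern_assoc)
    ultimately show ?thesis
      unfolding truss_units_def using t s m n ts st id by auto
  qed
  \<comment> \<open>Conversely, projecting an inverse and its two equations to \<open>T\<close>
    gives an inverse of t.\<close>
  moreover have "t \<in> truss_units T \<and> m \<in> carrier M" if "(t, m) \<in> truss_units (ext_truss T M e)" for t m
    using that u(1) unfolding truss_units_def id by auto
  ultimately show ?thesis by auto
qed

end

theorem theorem4p4:
  fixes T :: "('t, 'x) truss_scheme"
    and M :: "('t, 'm, 'y) tmodule_scheme"
    and e :: 'm
  assumes "truss T"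
    and "left_tmodule T M"
    and "e \<in> carrier M"
  shows
    \<comment> \<open>(1)\<close>
    "(\<forall>e'\<in>carrier M. truss_isomorphic (ext_truss T M e) (ext_truss T M e')) \<and>

     \<comment> \<open>(2)\<close>
     left_tmodule (ext_truss T M e) (ext_tmodule M e) \<and>
     (\<forall>t\<in>carrier T. \<forall>m\<in>carrier M. act (ext_tmodule M e) (t, m) e = m) \<and>

     \<comment> \<open>(3)\<close>
     (\<forall>e'\<in>carrier M. \<forall>t\<in>carrier T. \<forall>m\<in>carrier M. \<forall>m'\<in>carrier M.
        induced_act (ext_tmodule M e) e' (t, m) m' = induced_act M e' t m') \<and>
     (\<forall>e'. tmodule_absorber T M e' \<longrightarrow>
        (\<forall>t\<in>carrier T. \<forall>m\<in>carrier M. \<forall>m'\<in>carrier M.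
          induced_act (ext_tmodule M e) e' (t, m) m' = act M t m')) \<and>

     \<comment> \<open>(4)\<close>
     (\<forall>a\<in>carrier T.
        paragon ({a} \<times> carrier M) (ext_truss T M e) \<and>
        truss_isomorphic (quot_truss (ext_truss T M e) ({a} \<times> carrier M)) T \<and>
        (truss_ideal ({a} \<times> carrier M) (ext_truss T M e) \<longleftrightarrow> truss_absorber T a)) \<and>

     \<comment> \<open>(5)\<close>
     sub_truss (carrier T \<times> {e}) (ext_truss T M e) \<and>
     (carrier T \<noteq> {} \<longrightarrow>
        left_paragon (carrier T \<times> {e}) (ext_truss T M e) \<and>
        tmodule_isomorphic (ext_truss T M e)
          (quot_tmodule (ext_truss T M e) (carrier T \<times> {e})) (ext_tmodule M e)) \<and>

     \<comment> \<open>(6)\<close>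
     (unital_truss (ext_truss T M e) \<longleftrightarrow> unital_truss T \<and> unital_tmodule T M) \<and>
     (unital_truss (ext_truss T M e) \<longrightarrow>
        truss_units (ext_truss T M e) = truss_units T \<times> carrier M)"
proof -
  interpret left_tmodule T M by fact
  note e = \<open>e \<in> carrier M\<close>
  have "act (ext_tmodule M e) (t, m) e = m" if "t \<in> carrier T" "m \<in> carrier M" for t m
    using that e by (simp add: closed cancel)
  moreover have "induced_act (ext_tmodule M e) e' (t, m) m' = act M t m'"
    if "tmodule_absorber T M e'" "t \<in> carrier T" "m \<in> carrier M" "m' \<in> carrier M" for e' t m m'
    using that e by (simp add: tmodule_absorber_def induced_act_ext_tmodule induced_act_absorber)
  \<comment> \<open>Thus the two unitality conditions in the theorem reduce to unitality of the
    module.\<close>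
  moreover have "unital_tmodule T M \<Longrightarrow> unital_truss T"
    unfolding unital_tmodule_def unital_truss_def using truss_axioms by blast
  ultimately show ?thesis
    using e by (auto simp del: ext_tmodule_simps simp: ext_truss_isomorphic ext_tmodule_is_tmodule
      induced_act_ext_tmodule paragon_fibre quot_truss_fibre_isomorphic truss_ideal_fibre_iff
      sub_truss_section left_paragon_section quot_tmodule_section_isomorphic unital_ext_truss_iff
      truss_units_ext_truss)
qed

end
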